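(* Assume the v-hinted Mv conjecture. Then for every $0<\tau<1$ and every constant $\varepsilon>0$, there is no dynamic algorithm with polynomial pre-processing time that maintains the product of two $n\times n$ (boolean) matrices under row updates and column queries with worst-case update time $O(n^{\omega(1,1,\tau)-\tau-\varepsilon})$ and worst-case query time $O(n^{1+\tau-\varepsilon})$. The same lower bound holds for any dynamic matrix product algorithm with column updates and row queries. With current bounds on $\omega$, balancing update and query time, this gives a lower bound of $\Omega(n^{1.528})$.
   Context: All computations are over the boolean semi-ring. The v-hinted Mv problem, for $t=n^\tau$ with $0<\tau<1$, has three phases: (1) input an $n\times t$ matrix $M$; (2) input a $t\times n$ matrix $V$; (3) input an index $i\in[n]$ and output $MV_{[n],i}$, i.e. the product of $M$ with the $i$-th column of $V$. The v-hinted Mv conjecture: for every constant $\varepsilon>0$, any algorithm solving this problem with polynomial time in phase 1 requires $\Omega(n^{\omega(1,1,\tau)-\varepsilon})$ operations in phase 2 or $\Omega(n^{1+\tau-\varepsilon})$ operations in phase 3. Here $\omega(a,b,c)$ is the exponent such that multiplying an $n^a\times n^b$ matrix by an $n^b\times n^c$ matrix takes $O(n^{\omega(a,b,c)})$ operations. A row update replaces a row of one of the factor matrices; a column query returns a column of the product.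
   Formalization: The final bound Ω(n^1.528) is stated under the hypothesis that the balance point τ with ω(1,1,τ)-τ = 1+τ exceeds 0.528 (current bounds on ω taken as tight), since known bounds on ω are only upper bounds; it says update and query time are not both O(n^1.528). *)

theory Defs
  imports Complex_Main "HOL-Library.Landau_Symbols"
begin

section \<open>Machine model: a word RAM\<close>

text \<open>
  Memory consists of arrays; cell k of array a in memory s is \<open>s a k\<close>. Array names are literals
  in the program text, so that a program uses only finitely many arrays, and array indices are
  computed at run time. Running time is the number of executed writes and tests; an expression
  occurring in a fixed program consists of boundedly many operations, hence this agrees up to a
  constant factor (depending on the program) with counting every single operation.

  Every number occurring in a computation (addresses included) has to stay below the bound W,
  otherwise the computation is stuck. An algorithm for problems with size parameter n is run with
  \<open>W = (n + 2) ^ c\<close> for a constant c of its own choice, i.e. with words of \<open>O(log n)\<close> bits.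
  Unit-cost arithmetic on unbounded numbers would be unreasonably strong here: a whole matrix
  column could be packed into a single number.
\<close>

datatype binop = Add | Sub | Mul | Div | Mod | BitAnd | BitOr | BitXor | Less | Equal

fun apply_op :: "binop \<Rightarrow> nat \<Rightarrow> nat \<Rightarrow> nat" where
  "apply_op Add x y = x + y"
| "apply_op Sub x y = x - y"
| "apply_op Mul x y = x * y"
| "apply_op Div x y = x div y"
| "apply_op Mod x y = x mod y"
| "apply_op BitAnd x y = and x y"
| "apply_op BitOr x y = or x y"
| "apply_op BitXor x y = xor x y"
| "apply_op Less x y = of_bool (x < y)"
| "apply_op Equal x y = of_bool (x = y)"

datatype expr = Const nat | Read nat expr | Bin binop expr expr

datatype prog =
    Skip
  | Write nat expr expr
  | Seq prog prog
  | Cond expr prog prog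
  | While expr prog

type_synonym memory = "nat \<Rightarrow> nat \<Rightarrow> nat"

definition fit :: "nat \<Rightarrow> nat \<Rightarrow> nat option" where
  "fit W x = (if x < W then Some x else None)"

fun eval :: "nat \<Rightarrow> memory \<Rightarrow> expr \<Rightarrow> nat option" where
  "eval W s (Const x) = fit W x"
| "eval W s (Read a e) = Option.bind (eval W s e) (\<lambda>k. fit W (s a k))"
| "eval W s (Bin f e1 e2) =
     Option.bind (eval W s e1) (\<lambda>x. Option.bind (eval W s e2) (\<lambda>y. fit W (apply_op f x y)))"

text \<open>\<open>run W P s k s'\<close>: started in memory s, program P halts after k steps in memory \<open>s'\<close>.\<close>

inductive run :: "nat \<Rightarrow> prog \<Rightarrow> memory \<Rightarrow> nat \<Rightarrow> memory \<Rightarrow> bool" for W :: nat where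
  Skip: "run W Skip s 0 s"
| Write: "eval W s e1 = Some i \<Longrightarrow> eval W s e2 = Some x \<Longrightarrow>
    run W (Write a e1 e2) s 1 (s(a := (s a)(i := x)))"
| Seq: "run W P s k s' \<Longrightarrow> run W Q s' l s'' \<Longrightarrow> run W (Seq P Q) s (k + l) s''"
| CondTrue: "eval W s e = Some x \<Longrightarrow> x \<noteq> 0 \<Longrightarrow> run W P s k s' \<Longrightarrow>
    run W (Cond e P Q) s (Suc k) s'"
| CondFalse: "eval W s e = Some 0 \<Longrightarrow> run W Q s k s' \<Longrightarrow> run W (Cond e P Q) s (Suc k) s'"
| WhileFalse: "eval W s e = Some 0 \<Longrightarrow> run W (While e P) s 1 s"
| WhileTrue: "eval W s e = Some x \<Longrightarrow> x \<noteq> 0 \<Longrightarrow> run W P s k s' \<Longrightarrow>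
    run W (While e P) s' l s'' \<Longrightarrow> run W (While e P) s (Suc (k + l)) s''"

definition halts_within :: "nat \<Rightarrow> prog \<Rightarrow> memory \<Rightarrow> nat \<Rightarrow> memory \<Rightarrow> bool" where
  "halts_within W P s T s' \<longleftrightarrow> (\<exists>k\<le>T. run W P s k s')"

definition word_bound :: "nat \<Rightarrow> nat \<Rightarrow> nat" where
  "word_bound c n = (n + 2) ^ c"

definition blank :: memory where
  "blank = (\<lambda>a k. 0)"

text \<open>Scalar arguments, first and second matrix (or vector) argument, and output.\<close>

abbreviation (input) ARGS :: nat where "ARGS \<equiv> 0"
abbreviation (input) IN1 :: nat where "IN1 \<equiv> 1"
abbreviation (input) IN2 :: nat where "IN2 \<equiv> 2"
abbreviation (input) OUT :: nat where "OUT \<equiv> 3"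

text \<open>Input is placed into the initial cells of an array; all other cells keep their contents.\<close>

definition load :: "nat \<Rightarrow> nat list \<Rightarrow> memory \<Rightarrow> memory" where
  "load a xs s = s(a := (\<lambda>k. if k < length xs then xs ! k else s a k))"


section \<open>Boolean matrices\<close>

text \<open>
  Rows and columns are numbered from 0. Dimensions are given separately, and entries outside of
  them are irrelevant.
\<close>

type_synonym bmat = "nat \<Rightarrow> nat \<Rightarrow> bool"
type_synonym bvec = "nat \<Rightarrow> bool"

text \<open>Product over the boolean semiring, with inner dimension t.\<close>

definition bmult :: "nat \<Rightarrow> bmat \<Rightarrow> bmat \<Rightarrow> bmat" where
  "bmult t A B = (\<lambda>i j. \<exists>k<t. A i k \<and> B k j)"

definition mat_row :: "bmat \<Rightarrow> nat \<Rightarrow> bvec" where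
  "mat_row A r = (\<lambda>j. A r j)"

definition mat_col :: "bmat \<Rightarrow> nat \<Rightarrow> bvec" where
  "mat_col A r = (\<lambda>i. A i r)"

definition set_row :: "bmat \<Rightarrow> nat \<Rightarrow> bvec \<Rightarrow> bmat" where
  "set_row A r v = (\<lambda>i j. if i = r then v j else A i j)"

definition set_col :: "bmat \<Rightarrow> nat \<Rightarrow> bvec \<Rightarrow> bmat" where
  "set_col A r v = (\<lambda>i j. if j = r then v i else A i j)"

definition vec_cells :: "nat \<Rightarrow> bvec \<Rightarrow> nat list" where
  "vec_cells n v = map (\<lambda>k. of_bool (v k)) [0..<n]"

definition mat_cells :: "nat \<Rightarrow> nat \<Rightarrow> bmat \<Rightarrow> nat list" where
  "mat_cells p q A = map (\<lambda>k. of_bool (A (k div q) (k mod q))) [0..<p * q]"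

definition holds_vec :: "memory \<Rightarrow> nat \<Rightarrow> nat \<Rightarrow> bvec \<Rightarrow> bool" where
  "holds_vec s a n v \<longleftrightarrow> (\<forall>k<n. s a k = of_bool (v k))"

definition holds_mat :: "memory \<Rightarrow> nat \<Rightarrow> nat \<Rightarrow> nat \<Rightarrow> bmat \<Rightarrow> bool" where
  "holds_mat s a p q A \<longleftrightarrow> (\<forall>i<p. \<forall>j<q. s a (i * q + j) = of_bool (A i j))"


section \<open>Asymptotic running time and the exponent of rectangular matrix multiplication\<close>

definition time_exponent :: "(nat \<Rightarrow> nat) \<Rightarrow> real \<Rightarrow> bool" where
  "time_exponent T x \<longleftrightarrow> (\<lambda>n. real (T n)) \<in> O(\<lambda>n. real n powr x)"

definition poly_time :: "(nat \<Rightarrow> nat) \<Rightarrow> bool" where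
  "poly_time T \<longleftrightarrow> (\<exists>d::nat. (\<lambda>n. real (T n)) \<in> O(\<lambda>n. real n ^ d))"

text \<open>The dimension written \<open>n\<^sup>a\<close>.\<close>

definition dim_pow :: "nat \<Rightarrow> real \<Rightarrow> nat" where
  "dim_pow n a = nat \<lceil>real n powr a\<rceil>"

definition multiplies :: "real \<Rightarrow> real \<Rightarrow> real \<Rightarrow> nat \<Rightarrow> prog \<Rightarrow> (nat \<Rightarrow> nat) \<Rightarrow> bool" where
  "multiplies a b c w P T \<longleftrightarrow>
     (\<forall>n A B. let p = dim_pow n a; q = dim_pow n b; r = dim_pow n c in
        \<exists>s. halts_within (word_bound w n) P
              (load ARGS [n, p, q, r] (load IN1 (mat_cells p q A) (load IN2 (mat_cells q r B) blank)))
              (T n) s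
          \<and> holds_mat s OUT p r (bmult q A B))"

definition omega :: "real \<Rightarrow> real \<Rightarrow> real \<Rightarrow> real" where
  "omega a b c = Inf {x. \<exists>w P T. multiplies a b c w P T \<and> time_exponent T x}"


section \<open>The v-hinted Mv problem\<close>

definition solves_v_hinted_Mv ::
  "real \<Rightarrow> nat \<Rightarrow> prog \<Rightarrow> prog \<Rightarrow> prog \<Rightarrow> (nat \<Rightarrow> nat) \<Rightarrow> (nat \<Rightarrow> nat) \<Rightarrow> (nat \<Rightarrow> nat) \<Rightarrow> bool" where
  "solves_v_hinted_Mv \<tau> w P1 P2 P3 T1 T2 T3 \<longleftrightarrow>
     (\<forall>n M. let t = dim_pow n \<tau>; W = word_bound w n in
        \<exists>s1. halts_within W P1 (load ARGS [n, t] (load IN1 (mat_cells n t M) blank)) (T1 n) s1 \<and>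
        (\<forall>V. \<exists>s2. halts_within W P2 (load ARGS [n, t] (load IN1 (mat_cells t n V) s1)) (T2 n) s2 \<and>
          (\<forall>i<n. \<exists>s3. halts_within W P3 (load ARGS [n, t, i] s2) (T3 n) s3 \<and>
             holds_vec s3 OUT n (mat_col (bmult t M V) i))))"

text \<open>
  ``Requires \<open>\<Omega>(f)\<close> in phase 2 or \<open>\<Omega>(g)\<close> in phase 3'' means that the times are not
  simultaneously \<open>O(f)\<close> and \<open>O(g)\<close>. A disjunction of two eventual lower bounds would be refuted
  by an algorithm that postpones all of its work to phase 3 for odd n only.
\<close>

definition v_hinted_Mv_conjecture :: bool where
  "v_hinted_Mv_conjecture \<longleftrightarrow>
     (\<forall>\<tau> \<epsilon>. 0 < \<tau> \<and> \<tau> < 1 \<and> 0 < \<epsilon> \<longrightarrow>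
        \<not> (\<exists>w P1 P2 P3 T1 T2 T3. solves_v_hinted_Mv \<tau> w P1 P2 P3 T1 T2 T3 \<and>
             poly_time T1 \<and>
             time_exponent T2 (omega 1 1 \<tau> - \<epsilon>) \<and>
             time_exponent T3 (1 + \<tau> - \<epsilon>)))"


section \<open>Dynamic matrix product\<close>

text \<open>
  The parameter put is the kind of update (\<^term>\<open>set_row\<close> or \<^term>\<open>set_col\<close>). The relation holds
  between the current factors A, B and the memory after the initialization and any sequence of
  updates and queries; queries may change the memory, too. The second scalar argument of an update
  tells which of the two factors is modified.
\<close>

inductive dyn_reach ::
  "(bmat \<Rightarrow> nat \<Rightarrow> bvec \<Rightarrow> bmat) \<Rightarrow> nat \<Rightarrow> nat \<Rightarrow> prog \<Rightarrow> prog \<Rightarrow> prog \<Rightarrow> bmat \<Rightarrow> bmat \<Rightarrow> memory \<Rightarrow> bool"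
  for put W n pre upd qry where
  init: "run W pre (load ARGS [n] (load IN1 (mat_cells n n A) (load IN2 (mat_cells n n B) blank))) k s
    \<Longrightarrow> dyn_reach put W n pre upd qry A B s"
| update_left: "dyn_reach put W n pre upd qry A B s \<Longrightarrow> r < n \<Longrightarrow>
    run W upd (load ARGS [n, 0, r] (load IN1 (vec_cells n v) s)) k s' \<Longrightarrow>
    dyn_reach put W n pre upd qry (put A r v) B s'"
| update_right: "dyn_reach put W n pre upd qry A B s \<Longrightarrow> r < n \<Longrightarrow>
    run W upd (load ARGS [n, 1, r] (load IN1 (vec_cells n v) s)) k s' \<Longrightarrow>
    dyn_reach put W n pre upd qry A (put B r v) s'"
| query: "dyn_reach put W n pre upd qry A B s \<Longrightarrow> j < n \<Longrightarrow>
    run W qry (load ARGS [n, j] s) k s' \<Longrightarrow>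
    dyn_reach put W n pre upd qry A B s'"

definition maintains_product ::
  "(bmat \<Rightarrow> nat \<Rightarrow> bvec \<Rightarrow> bmat) \<Rightarrow> (bmat \<Rightarrow> nat \<Rightarrow> bvec) \<Rightarrow> nat \<Rightarrow> prog \<Rightarrow> prog \<Rightarrow> prog \<Rightarrow>
   (nat \<Rightarrow> nat) \<Rightarrow> (nat \<Rightarrow> nat) \<Rightarrow> (nat \<Rightarrow> nat) \<Rightarrow> bool" where
  "maintains_product put get w pre upd qry Tp Tu Tq \<longleftrightarrow>
     (\<forall>n. let W = word_bound w n in
       (\<forall>A B. \<exists>s. halts_within W pre
          (load ARGS [n] (load IN1 (mat_cells n n A) (load IN2 (mat_cells n n B) blank))) (Tp n) s) \<and>
       (\<forall>A B s. dyn_reach put W n pre upd qry A B s \<longrightarrow>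
          (\<forall>side\<in>{0, 1}. \<forall>r<n. \<forall>v. \<exists>s'. halts_within W upd
             (load ARGS [n, side, r] (load IN1 (vec_cells n v) s)) (Tu n) s') \<and>
          (\<forall>j<n. \<exists>s'. halts_within W qry (load ARGS [n, j] s) (Tq n) s' \<and>
             holds_vec s' OUT n (get (bmult n A B) j))))"

text \<open>
  Existence of a dynamic algorithm with polynomial pre-processing time and worst-case update and
  query times \<open>O(n\<^sup>x)\<close> and \<open>O(n\<^sup>y)\<close>.
\<close>

definition dynamic_product_algorithm ::
  "(bmat \<Rightarrow> nat \<Rightarrow> bvec \<Rightarrow> bmat) \<Rightarrow> (bmat \<Rightarrow> nat \<Rightarrow> bvec) \<Rightarrow> real \<Rightarrow> real \<Rightarrow> bool" where
  "dynamic_product_algorithm put get x y \<longleftrightarrow>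
     (\<exists>w pre upd qry Tp Tu Tq. maintains_product put get w pre upd qry Tp Tu Tq \<and>
        poly_time Tp \<and> time_exponent Tu x \<and> time_exponent Tq y)"

end

theory Submission
  imports Defs
begin

text \<open>
  A dynamic algorithm answers the hinted problem as follows. Phase 1 initializes it with zero
  matrices and inserts M row by row, phase 2 inserts the rows of V by t updates, and phase 3 is a
  single query. Column updates and row queries are the same thing for the transposed matrices,
  with the factors interchanged. Copying a row costs O(n), which could exceed the update time that
  is granted. But an update that does not read every cell of its input cannot be correct, as the
  following update overwrites the unread cells; hence the update time is at least linear.
\<close>

section \<open>Runs of programs\<close>

text \<open>The dynamic algorithm keeps private state between calls, while the surrounding program
  needs arguments, input and counters of its own. The arrays of the former are therefore renamed
  injectively by \<open>shift\<close>: its memory is then exactly the view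
  \<open>s \<circ> shift\<close>, and arrays outside the range of \<open>shift\<close> survive each
  call. Addressing a whole matrix costs only a larger exponent in the word bound.

  Since \<open>\<epsilon>\<close> is arbitrary, the granted exponent
  \<open>omega 1 1 \<tau> - \<tau> - \<epsilon>\<close> may lie below 1 whatever
  \<open>omega\<close> is, so the copying cost cannot be compared with it directly. The linear bound
  is a property of the update program itself and follows by an adversary argument: inputs that
  differ in one unread cell lead to memories that differ at most there, the next loaded row erases
  the difference, and one deterministic query would have to give two different answers. For this
  purpose every run comes with a set of cells that determines it, of size at most the number of
  steps times a constant of the program.\<close>

lemma fit_mono: "fit W x = Some y \<Longrightarrow> W \<le> W' \<Longrightarrow> fit W' x = Some y"
  by (auto simp: fit_def split: if_splits)

lemma eval_mono:
  assumes "W \<le> W'"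
  shows "eval W s e = Some x \<Longrightarrow> eval W' s e = Some x"
  by (induction e arbitrary: x) (auto simp: bind_eq_Some_conv intro: fit_mono[OF _ assms])

lemma run_mono:
  assumes "W \<le> W'"
  shows "run W P s k u \<Longrightarrow> run W' P s k u"
  by (induction rule: run.induct) (blast intro: run.intros eval_mono[OF assms])+

inductive_cases run_SkipE: "run W Skip s k u"
inductive_cases run_WriteE: "run W (Write a e1 e2) s k u"
inductive_cases run_SeqE: "run W (Seq P Q) s k u"
inductive_cases run_CondE: "run W (Cond e P Q) s k u"
inductive_cases run_WhileE: "run W (While e P) s k u"

text \<open>Needed to identify the answers promised for two different products that one and the same
  memory represents.\<close>

lemma run_deterministic: "run W P s k u \<Longrightarrow> run W P s k' u' \<Longrightarrow> u' = u"
proof (induction arbitrary: k' u' rule: run.induct)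
  case Skip
  then show ?case by (auto elim: run_SkipE)
next
  case Write
  then show ?case by (auto elim: run_WriteE)
next
  case Seq
  then show ?case by (blast elim: run_SeqE)
next
  case CondTrue
  from CondTrue.prems show ?case
    by (rule run_CondE) (blast intro: CondTrue.IH, use CondTrue.hyps in simp)
next
  case CondFalse
  from CondFalse.prems show ?case
    by (rule run_CondE) (use CondFalse.hyps in simp, blast intro: CondFalse.IH)
next
  case WhileFalse
  then show ?case by (auto elim: run_WhileE)
next
  case (WhileTrue s e x P k s' l s'')
  from WhileTrue.prems show ?case
    by (rule run_WhileE) (use WhileTrue.hyps(1,2) in simp, use WhileTrue.IH in blast)
qed

section \<open>Sequencing and counting loops\<close>

lemma halts_within_Write:
  "eval W s e1 = Some i \<Longrightarrow> eval W s e2 = Some x \<Longrightarrow>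
    halts_within W (Write a e1 e2) s 1 (s(a := (s a)(i := x)))"
  unfolding halts_within_def by (blast intro: run.Write)

lemma halts_within_Seq:
  "halts_within W P s T u \<Longrightarrow> halts_within W Q u T' u' \<Longrightarrow>
    halts_within W (Seq P Q) s (T + T') u'"
  unfolding halts_within_def by (blast intro: run.Seq add_mono)

text \<open>Counters live in array 2: the hinted problem never loads input there, and renamed
  programs cannot reach it, as it is outside the range of \<open>shift\<close>.\<close>

definition incr :: "nat \<Rightarrow> prog" where
  "incr x = Write 2 (Const x) (Bin Add (Read 2 (Const x)) (Const 1))"

definition for_loop :: "nat \<Rightarrow> expr \<Rightarrow> prog \<Rightarrow> prog" where
  "for_loop x e P =
     Seq (Write 2 (Const x) (Const 0)) (While (Bin Less (Read 2 (Const x)) e) (Seq P (incr x)))"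

text \<open>Induction on the remaining rounds. A round costs \<open>c\<close> for the body, one step
  for the increment and one for the test; the final \<open>1\<close> is the failing test. The
  expression \<open>e\<close> is evaluated anew in each test, so the invariant has to preserve its
  value. The counter reaches \<open>N\<close>, which must therefore fit into a word.\<close>

lemma halts_within_while_counter:
  assumes step: "\<And>i s. i < N \<Longrightarrow> I i s \<Longrightarrow>
      \<exists>u. halts_within W P s c u \<and> u 2 x = i \<and> I (Suc i) (u(2 := (u 2)(x := Suc i)))"
    and counter: "\<And>i s. i \<le> N \<Longrightarrow> I i s \<Longrightarrow> s 2 x = i \<and> eval W s e = Some N"
    and W: "N < W" "x < W"
    and "i \<le> N" "I i s"
  shows "\<exists>u. halts_within W (While (Bin Less (Read 2 (Const x)) e) (Seq P (incr x))) s
               ((N - i) * (c + 2) + 1) u \<and> I N u"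
  using \<open>i \<le> N\<close> \<open>I i s\<close>
proof (induction i arbitrary: s rule: inc_induct)
  case base
  have "eval W s (Bin Less (Read 2 (Const x)) e) = Some 0"
    using counter[OF order_refl base] W by (simp add: fit_def)
  from run.WhileFalse[OF this] base show ?case
    unfolding halts_within_def by (metis le_add2)
next
  case (step i)
  from assms(1)[OF step.hyps(2) step.prems] obtain u where
    u: "halts_within W P s c u" "u 2 x = i" "I (Suc i) (u(2 := (u 2)(x := Suc i)))"
    by blast
  obtain k where k: "k \<le> c" "run W P s k u"
    using u(1) unfolding halts_within_def by blast
  have "run W (incr x) u 1 (u(2 := (u 2)(x := Suc i)))"
    unfolding incr_def
    using u(2) W step.hyps by (intro run.Write) (auto simp: fit_def)
  then have body: "run W (Seq P (incr x)) s (k + 1) (u(2 := (u 2)(x := Suc i)))"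
    using k(2) by (rule run.Seq[rotated])
  obtain u' l where u': "l \<le> (N - Suc i) * (c + 2) + 1"
    "run W (While (Bin Less (Read 2 (Const x)) e) (Seq P (incr x))) (u(2 := (u 2)(x := Suc i))) l u'"
    "I N u'"
    using step.IH[OF u(3)] unfolding halts_within_def by blast
  have "eval W s (Bin Less (Read 2 (Const x)) e) = Some 1"
    using counter[OF less_imp_le[OF step.hyps(2)] step.prems] W step.hyps by (simp add: fit_def)
  from run.WhileTrue[OF this _ body u'(2)]
  have "run W (While (Bin Less (Read 2 (Const x)) e) (Seq P (incr x))) s (Suc (k + 1 + l)) u'"
    by simp
  moreover have "Suc (k + 1 + l) \<le> (N - i) * (c + 2) + 1"
  proof -
    have "N - i = Suc (N - Suc i)" using step.hyps by simp
    then show ?thesis using k(1) u'(1) by simp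
  qed
  ultimately show ?case using u'(3) unfolding halts_within_def by blast
qed

lemma halts_within_for_loop:
  assumes "\<And>i s. i < N \<Longrightarrow> I i s \<Longrightarrow>
      \<exists>u. halts_within W P s c u \<and> u 2 x = i \<and> I (Suc i) (u(2 := (u 2)(x := Suc i)))"
    and "\<And>i s. i \<le> N \<Longrightarrow> I i s \<Longrightarrow> s 2 x = i \<and> eval W s e = Some N"
    and W: "N < W" "x < W"
    and init: "I 0 (s(2 := (s 2)(x := 0)))"
  shows "\<exists>u. halts_within W (for_loop x e P) s (N * (c + 2) + 2) u \<and> I N u"
proof -
  have "halts_within W (Write 2 (Const x) (Const 0)) s 1 (s(2 := (s 2)(x := 0)))"
    using W by (intro halts_within_Write) (auto simp: fit_def)
  moreover obtain u where "halts_within W (While (Bin Less (Read 2 (Const x)) e) (Seq P (incr x)))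
      (s(2 := (s 2)(x := 0))) (N * (c + 2) + 1) u" "I N u"
    using halts_within_while_counter[of N I W P c x e 0, OF assms(1-4) le0 init]
    unfolding minus_nat.diff_0 by blast
  ultimately show ?thesis
    unfolding for_loop_def using halts_within_Seq by fastforce
qed


section \<open>Renaming of arrays\<close>

fun rename_expr :: "(nat \<Rightarrow> nat) \<Rightarrow> expr \<Rightarrow> expr" where
  "rename_expr \<rho> (Const x) = Const x"
| "rename_expr \<rho> (Read a e) = Read (\<rho> a) (rename_expr \<rho> e)"
| "rename_expr \<rho> (Bin f e1 e2) = Bin f (rename_expr \<rho> e1) (rename_expr \<rho> e2)"

fun rename :: "(nat \<Rightarrow> nat) \<Rightarrow> prog \<Rightarrow> prog" where
  "rename \<rho> Skip = Skip"
| "rename \<rho> (Write a e1 e2) = Write (\<rho> a) (rename_expr \<rho> e1) (rename_expr \<rho> e2)"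
| "rename \<rho> (Seq P Q) = Seq (rename \<rho> P) (rename \<rho> Q)"
| "rename \<rho> (Cond e P Q) = Cond (rename_expr \<rho> e) (rename \<rho> P) (rename \<rho> Q)"
| "rename \<rho> (While e P) = While (rename_expr \<rho> e) (rename \<rho> P)"

lemma eval_rename: "eval W s (rename_expr \<rho> e) = eval W (s \<circ> \<rho>) e"
  by (induction e) auto

text \<open>Injectivity ensures that a write to \<open>\<rho> a\<close> changes the view
  \<open>s \<circ> \<rho>\<close> in array \<open>a\<close> only. The frame condition protects the
  counters and inputs of the surrounding program.\<close>

lemma run_rename:
  assumes "inj \<rho>"
  shows "run W P m k m' \<Longrightarrow> m = s \<circ> \<rho> \<Longrightarrow>
    \<exists>u. run W (rename \<rho> P) s k u \<and> m' = u \<circ> \<rho> \<and> (\<forall>b. b \<notin> range \<rho> \<longrightarrow> u b = s b)"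
proof (induction arbitrary: s rule: run.induct)
  case (Skip m)
  then show ?case by (auto intro: run.Skip)
next
  case (Write m e1 i e2 x a)
  let ?u = "s(\<rho> a := (s (\<rho> a))(i := x))"
  have "run W (rename \<rho> (Write a e1 e2)) s 1 ?u"
    using Write.hyps unfolding rename.simps Write.prems by (intro run.Write) (simp_all only: eval_rename)
  moreover have "m(a := (m a)(i := x)) = ?u \<circ> \<rho>"
    using Write.prems assms by (auto simp: fun_eq_iff inj_eq)
  moreover have "\<forall>b. b \<notin> range \<rho> \<longrightarrow> ?u b = s b" by auto
  ultimately show ?case by blast
next
  case (Seq P m k m' Q l m'')
  from Seq.IH(1)[OF Seq.prems] obtain u where
    u: "run W (rename \<rho> P) s k u" "m' = u \<circ> \<rho>" "\<forall>b. b \<notin> range \<rho> \<longrightarrow> u b = s b" by blast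
  from Seq.IH(2)[OF u(2)] u show ?case by (fastforce intro: run.Seq)
next
  case (CondTrue m e x P k m' Q)
  have "eval W s (rename_expr \<rho> e) = Some x"
    using CondTrue.hyps(1) unfolding CondTrue.prems by (simp only: eval_rename)
  then show ?case
    using CondTrue.IH[OF CondTrue.prems] CondTrue.hyps by (fastforce intro: run.CondTrue)
next
  case (CondFalse m e Q k m' P)
  have "eval W s (rename_expr \<rho> e) = Some 0"
    using CondFalse.hyps(1) unfolding CondFalse.prems by (simp only: eval_rename)
  then show ?case
    using CondFalse.IH[OF CondFalse.prems] by (fastforce intro: run.CondFalse)
next
  case (WhileFalse m e P)
  have "eval W s (rename_expr \<rho> e) = Some 0"
    using WhileFalse.hyps unfolding WhileFalse.prems by (simp only: eval_rename)
  then show ?case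
    unfolding rename.simps using run.WhileFalse WhileFalse.prems by blast
next
  case (WhileTrue m e x P k m' l m'')
  have e: "eval W s (rename_expr \<rho> e) = Some x"
    using WhileTrue.hyps(1) unfolding WhileTrue.prems by (simp only: eval_rename)
  from WhileTrue.IH(1)[OF WhileTrue.prems] obtain u where
    u: "run W (rename \<rho> P) s k u" "m' = u \<circ> \<rho>" "\<forall>b. b \<notin> range \<rho> \<longrightarrow> u b = s b" by blast
  from WhileTrue.IH(2)[OF u(2)] obtain u' where
    u': "run W (While (rename_expr \<rho> e) (rename \<rho> P)) u l u'" "m'' = u' \<circ> \<rho>"
      "\<forall>b. b \<notin> range \<rho> \<longrightarrow> u' b = u b" unfolding rename.simps by blast
  have "\<forall>b. b \<notin> range \<rho> \<longrightarrow> u' b = s b" using u(3) u'(3) by metis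
  with run.WhileTrue[OF e WhileTrue.hyps(2) u(1) u'(1)] u'(2) show ?case
    unfolding rename.simps by blast
qed

lemma halts_within_rename:
  assumes "inj \<rho>" "halts_within W P (s \<circ> \<rho>) T m" "W \<le> W'"
  shows "\<exists>u. halts_within W' (rename \<rho> P) s T u \<and> m = u \<circ> \<rho> \<and> (\<forall>b. b \<notin> range \<rho> \<longrightarrow> u b = s b)"
proof -
  obtain k where "k \<le> T" "run W' P (s \<circ> \<rho>) k m"
    using assms(2) run_mono[OF assms(3)] unfolding halts_within_def by blast
  then show ?thesis using run_rename[OF assms(1) _ refl] unfolding halts_within_def by blast
qed

text \<open>Keeps the output array in place and vacates the arrays for arguments, input and counters.\<close>

definition shift :: "nat \<Rightarrow> nat" where
  "shift a = (if a = OUT then OUT else a + 4)"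

lemma inj_shift: "inj shift"
  by (auto simp: inj_def shift_def split: if_splits)

lemma low_notin_range_shift: "b < 3 \<Longrightarrow> b \<notin> range shift"
  by (auto simp: shift_def)


section \<open>Unread cells\<close>

fun expr_reads :: "memory \<Rightarrow> nat \<Rightarrow> expr \<Rightarrow> (nat \<times> nat) set" where
  "expr_reads s W (Const x) = {}"
| "expr_reads s W (Read a e) =
     expr_reads s W e \<union> (case eval W s e of None \<Rightarrow> {} | Some k \<Rightarrow> {(a, k)})"
| "expr_reads s W (Bin f e1 e2) = expr_reads s W e1 \<union> expr_reads s W e2"

fun expr_cost :: "expr \<Rightarrow> nat" where
  "expr_cost (Const x) = 0"
| "expr_cost (Read a e) = Suc (expr_cost e)"
| "expr_cost (Bin f e1 e2) = expr_cost e1 + expr_cost e2"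

text \<open>A single step evaluates the expressions of one write or of one test, so the number of
  all \<open>Read\<close> occurrences in the program bounds the cells inspected in it.\<close>

fun step_cost :: "prog \<Rightarrow> nat" where
  "step_cost Skip = 0"
| "step_cost (Write a e1 e2) = expr_cost e1 + expr_cost e2"
| "step_cost (Seq P Q) = step_cost P + step_cost Q"
| "step_cost (Cond e P Q) = expr_cost e + step_cost P + step_cost Q"
| "step_cost (While e P) = expr_cost e + step_cost P"

definition agree :: "(nat \<times> nat) set \<Rightarrow> memory \<Rightarrow> memory \<Rightarrow> bool" where
  "agree S s s' \<longleftrightarrow> (\<forall>(a, i)\<in>S. s' a i = s a i)"

lemma agree_Un [simp]: "agree (S \<union> S') s s' \<longleftrightarrow> agree S s s' \<and> agree S' s s'"
  by (auto simp: agree_def)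

lemma finite_expr_reads: "finite (expr_reads s W e)"
  by (induction e) (auto split: option.splits)

lemma card_expr_reads: "card (expr_reads s W e) \<le> expr_cost e"
proof (induction e)
  case (Read a e)
  have "card (expr_reads s W e \<union> (case eval W s e of None \<Rightarrow> {} | Some k \<Rightarrow> {(a, k)}))
      \<le> card (expr_reads s W e) + 1"
    by (rule order_trans[OF card_Un_le]) (auto split: option.splits)
  then show ?case using Read by simp
next
  case (Bin f e1 e2)
  then show ?case using card_Un_le[of "expr_reads s W e1" "expr_reads s W e2"] by simp
qed simp

lemma eval_agree: "agree (expr_reads s W e) s s' \<Longrightarrow> eval W s' e = eval W s e"
proof (induction e)
  case (Read a e)
  then show ?case
    by (cases "eval W s e") (auto simp: agree_def)
qed auto

text \<open>The second alternative stands for the cells that are written in neither run.\<close>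

definition parallel :: "memory \<Rightarrow> memory \<Rightarrow> memory \<Rightarrow> memory \<Rightarrow> bool" where
  "parallel s u s' u' \<longleftrightarrow> (\<forall>a i. u' a i = u a i \<or> (u' a i = s' a i \<and> u a i = s a i))"

text \<open>This allows read sets of consecutive runs to be united: the second set is collected in
  the intermediate memory, but agreement on it can be demanded at the start, because a cell either
  ends with equal values or keeps both of its old ones.\<close>

lemma parallel_agree: "parallel s u s' u' \<Longrightarrow> agree S s s' \<Longrightarrow> agree S u u'"
  unfolding parallel_def agree_def by fastforce

lemma parallel_trans: "parallel s u s' u' \<Longrightarrow> parallel u v u' v' \<Longrightarrow> parallel s v s' v'"
  unfolding parallel_def by metis

definition depends_on :: "nat \<Rightarrow> prog \<Rightarrow> memory \<Rightarrow> nat \<Rightarrow> memory \<Rightarrow> (nat \<times> nat) set \<Rightarrow> bool" where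
  "depends_on W P s k u S \<longleftrightarrow>
     (\<forall>s'. agree S s s' \<longrightarrow> (\<exists>u'. run W P s' k u' \<and> parallel s u s' u'))"

text \<open>The read cells are collected along the run. Agreement on them gives every expression the
  same value, hence the same branches, the same step count and the same writes. Cells that the run
  itself has written before reading are included as well, which only enlarges
  \<open>S\<close>.\<close>

lemma few_cells_read:
  "run W P s k u \<Longrightarrow> \<exists>S. finite S \<and> card S \<le> k * step_cost P \<and> depends_on W P s k u S"
proof (induction rule: run.induct)
  case (Skip s)
  then show ?case
    by (intro exI[of _ "{}"]) (auto simp: depends_on_def parallel_def intro: run.Skip)
next
  case (Write s e1 i e2 x a)
  let ?S = "expr_reads s W e1 \<union> expr_reads s W e2"
  have "card ?S \<le> 1 * step_cost (Write a e1 e2)"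
    using card_Un_le[of "expr_reads s W e1" "expr_reads s W e2"]
      card_expr_reads[of s W e1] card_expr_reads[of s W e2] by simp
  moreover have "depends_on W (Write a e1 e2) s 1 (s(a := (s a)(i := x))) ?S"
    unfolding depends_on_def
  proof (intro allI impI)
    fix s' assume "agree ?S s s'"
    then have "run W (Write a e1 e2) s' 1 (s'(a := (s' a)(i := x)))"
      using Write by (intro run.Write) (metis agree_Un eval_agree)+
    then show "\<exists>u'. run W (Write a e1 e2) s' 1 u' \<and> parallel s (s(a := (s a)(i := x))) s' u'"
      by (intro exI conjI) (auto simp: parallel_def)
  qed
  moreover have "finite ?S" by (simp add: finite_expr_reads)
  ultimately show ?case by blast
next
  case (Seq P s k s' Q l s'')
  then obtain S S' where
    S: "finite S" "card S \<le> k * step_cost P" "depends_on W P s k s' S" and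
    S': "finite S'" "card S' \<le> l * step_cost Q" "depends_on W Q s' l s'' S'" by blast
  have "card (S \<union> S') \<le> (k + l) * step_cost (Seq P Q)"
    using card_Un_le[of S S'] S(2) S'(2) by (simp add: algebra_simps)
  moreover have "depends_on W (Seq P Q) s (k + l) s'' (S \<union> S')"
    using S(3) S'(3) unfolding depends_on_def agree_Un
    by (meson parallel_agree parallel_trans run.Seq)
  ultimately show ?case using S S' by (intro exI[of _ "S \<union> S'"]) simp
next
  case (CondTrue s e x P k s' Q)
  then obtain S where S: "finite S" "card S \<le> k * step_cost P" "depends_on W P s k s' S" by blast
  have "card (expr_reads s W e \<union> S) \<le> Suc k * step_cost (Cond e P Q)"
    using card_Un_le[of "expr_reads s W e" S] S(2) card_expr_reads[of s W e]
    by (simp add: algebra_simps)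
  moreover have "depends_on W (Cond e P Q) s (Suc k) s' (expr_reads s W e \<union> S)"
    using S(3) CondTrue.hyps unfolding depends_on_def agree_Un
    by (metis eval_agree run.CondTrue)
  ultimately show ?case
    using S by (intro exI[of _ "expr_reads s W e \<union> S"]) (simp add: finite_expr_reads)
next
  case (CondFalse s e Q k s' P)
  then obtain S where S: "finite S" "card S \<le> k * step_cost Q" "depends_on W Q s k s' S" by blast
  have "card (expr_reads s W e \<union> S) \<le> Suc k * step_cost (Cond e P Q)"
    using card_Un_le[of "expr_reads s W e" S] S(2) card_expr_reads[of s W e]
    by (simp add: algebra_simps)
  moreover have "depends_on W (Cond e P Q) s (Suc k) s' (expr_reads s W e \<union> S)"
    using S(3) CondFalse.hyps unfolding depends_on_def agree_Un
    by (metis eval_agree run.CondFalse)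
  ultimately show ?case
    using S by (intro exI[of _ "expr_reads s W e \<union> S"]) (simp add: finite_expr_reads)
next
  case (WhileFalse s e P)
  have "depends_on W (While e P) s 1 s (expr_reads s W e)"
    using WhileFalse unfolding depends_on_def
    by (metis eval_agree run.WhileFalse parallel_def)
  then show ?case
    using card_expr_reads[of s W e]
    by (intro exI[of _ "expr_reads s W e"]) (simp add: finite_expr_reads)
next
  case (WhileTrue s e x P k s' l s'')
  then obtain S S' where
    S: "finite S" "card S \<le> k * step_cost P" "depends_on W P s k s' S" and
    S': "finite S'" "card S' \<le> l * step_cost (While e P)" "depends_on W (While e P) s' l s'' S'"
    by blast
  let ?S = "expr_reads s W e \<union> (S \<union> S')"
  have "card ?S \<le> Suc (k + l) * step_cost (While e P)"
    using card_Un_le[of "expr_reads s W e" "S \<union> S'"] card_Un_le[of S S'] S(2) S'(2)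
      card_expr_reads[of s W e]
    by (simp add: algebra_simps)
  moreover have "depends_on W (While e P) s (Suc (k + l)) s'' ?S"
    unfolding depends_on_def
  proof (intro allI impI)
    fix t assume t: "agree ?S s t"
    then obtain t' where t': "run W P t k t'" "parallel s s' t t'"
      using S(3) unfolding depends_on_def by auto
    with t obtain t'' where t'': "run W (While e P) t' l t''" "parallel s' s'' t' t''"
      using S'(3) parallel_agree unfolding depends_on_def by (metis agree_Un)
    have "eval W t e = Some x" using t WhileTrue.hyps(1) by (metis agree_Un eval_agree)
    then show "\<exists>t''. run W (While e P) t (Suc (k + l)) t'' \<and> parallel s s'' t t''"
      using run.WhileTrue[OF _ WhileTrue.hyps(2) t'(1) t''(1)] parallel_trans[OF t'(2) t''(2)]
      by blast
  qed
  ultimately show ?case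
    using S S' by (intro exI[of _ ?S]) (simp add: finite_expr_reads)
qed


section \<open>Row updates of both factors\<close>

text \<open>
  In \<open>R n X Y s\<close>, memory s represents the product of X and Y. Row updates of X and Y are calls of
  the update program with side \<open>lft\<close> and \<open>rgt\<close>, and queries return columns.
\<close>

locale dynamic_rows =
  fixes w :: nat and pre upd qry :: prog and Tp Tu Tq :: "nat \<Rightarrow> nat" and lft rgt :: nat
    and R :: "nat \<Rightarrow> bmat \<Rightarrow> bmat \<Rightarrow> memory \<Rightarrow> bool"
  assumes sides: "lft < 2" "rgt < 2"
    and init: "\<exists>s. halts_within (word_bound w n) pre (load ARGS [n] blank) (Tp n) s \<and>
      R n (\<lambda>i j. False) (\<lambda>i j. False) s"
    and lft_halts: "R n X Y s \<Longrightarrow> r < n \<Longrightarrow> \<exists>s'. halts_within (word_bound w n) upd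
      (load ARGS [n, lft, r] (load IN1 (vec_cells n v) s)) (Tu n) s'"
    and rgt_halts: "R n X Y s \<Longrightarrow> r < n \<Longrightarrow> \<exists>s'. halts_within (word_bound w n) upd
      (load ARGS [n, rgt, r] (load IN1 (vec_cells n v) s)) (Tu n) s'"
    and lft_step: "R n X Y s \<Longrightarrow> r < n \<Longrightarrow>
      run (word_bound w n) upd (load ARGS [n, lft, r] (load IN1 (vec_cells n v) s)) k s' \<Longrightarrow>
      R n (set_row X r v) Y s'"
    and rgt_step: "R n X Y s \<Longrightarrow> r < n \<Longrightarrow>
      run (word_bound w n) upd (load ARGS [n, rgt, r] (load IN1 (vec_cells n v) s)) k s' \<Longrightarrow>
      R n X (set_row Y r v) s'"
    and query: "R n X Y s \<Longrightarrow> j < n \<Longrightarrow> \<exists>s'. halts_within (word_bound w n) qry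
      (load ARGS [n, j] s) (Tq n) s' \<and> holds_vec s' OUT n (mat_col (bmult n X Y) j)"

section \<open>Dynamic product algorithms as instances\<close>

lemma load_zero_matrices:
  "load IN1 (mat_cells n n (\<lambda>i j. False)) (load IN2 (mat_cells n n (\<lambda>i j. False)) blank) = blank"
  by (auto simp: load_def mat_cells_def blank_def fun_eq_iff)

lemma maintains_product_halts:
  assumes "maintains_product put get w pre upd qry Tp Tu Tq"
  shows "\<exists>s. halts_within (word_bound w n) pre (load ARGS [n] (load IN1 (mat_cells n n A)
           (load IN2 (mat_cells n n B) blank))) (Tp n) s"
    and "dyn_reach put (word_bound w n) n pre upd qry A B s \<Longrightarrow> side \<in> {0, 1} \<Longrightarrow> r < n \<Longrightarrow>
      \<exists>s'. halts_within (word_bound w n) upd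
        (load ARGS [n, side, r] (load IN1 (vec_cells n v) s)) (Tu n) s'"
    and "dyn_reach put (word_bound w n) n pre upd qry A B s \<Longrightarrow> j < n \<Longrightarrow>
      \<exists>s'. halts_within (word_bound w n) qry (load ARGS [n, j] s) (Tq n) s' \<and>
        holds_vec s' OUT n (get (bmult n A B) j)"
  using assms unfolding maintains_product_def Let_def by blast+

text \<open>Zero matrices are the convenient start: their cells coincide with blank memory, so
  nothing has to be copied before the pre-processing is called.\<close>

lemma maintains_product_init:
  assumes "maintains_product put get w pre upd qry Tp Tu Tq"
  shows "\<exists>s. halts_within (word_bound w n) pre (load ARGS [n] blank) (Tp n) s \<and>
    dyn_reach put (word_bound w n) n pre upd qry (\<lambda>i j. False) (\<lambda>i j. False) s"
  using maintains_product_halts(1)[OF assms, of n "\<lambda>i j. False" "\<lambda>i j. False"]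
    dyn_reach.init[of "word_bound w n" pre n "\<lambda>i j. False" "\<lambda>i j. False" _ _ put upd qry]
  unfolding load_zero_matrices halts_within_def by blast

lemma dynamic_rows_of_set_row:
  assumes "maintains_product set_row mat_col w pre upd qry Tp Tu Tq"
  shows "dynamic_rows w pre upd qry Tp Tu Tq 0 1
    (\<lambda>n. dyn_reach set_row (word_bound w n) n pre upd qry)"
  using maintains_product_halts(2,3)[OF assms] maintains_product_init[OF assms]
  by unfold_locales (simp_all add: dyn_reach.update_left dyn_reach.update_right)

lemma dynamic_rows_of_set_col:
  assumes "maintains_product set_col mat_row w pre upd qry Tp Tu Tq"
  shows "dynamic_rows w pre upd qry Tp Tu Tq 1 0
    (\<lambda>n X Y. dyn_reach set_col (word_bound w n) n pre upd qry (\<lambda>i j. Y j i) (\<lambda>i j. X j i))"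
proof -
  have set: "(\<lambda>i j. set_row X r v j i) = set_col (\<lambda>i j. X j i) r v" for X r v
    by (simp add: set_row_def set_col_def)
  have get: "mat_row (bmult n (\<lambda>i j. Y j i) (\<lambda>i j. X j i)) j = mat_col (bmult n X Y) j" for n X Y j
    by (auto simp: mat_row_def mat_col_def bmult_def)
  show ?thesis
    using maintains_product_halts(2)[OF assms] maintains_product_init[OF assms]
      maintains_product_halts(3)[OF assms, where A = "\<lambda>i j. Y j i" and B = "\<lambda>i j. X j i" for X Y,
        unfolded get]
    by unfold_locales (simp_all add: set dyn_reach.update_left dyn_reach.update_right)
qed

lemma length_vec_cells [simp]: "length (vec_cells n v) = n"
  by (simp add: vec_cells_def)

lemma nth_vec_cells [simp]: "k < n \<Longrightarrow> vec_cells n v ! k = of_bool (v k)"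
  by (simp add: vec_cells_def)

section \<open>A linear lower bound on the update time\<close>

context dynamic_rows
begin

text \<open>Row 0 of the left factor is all ones, so entry 0 of column \<open>j\<close> of the
  product tells whether column \<open>j\<close> of the right factor is nonzero. Row 0 of the right
  factor receives either zeros or the unit vector at the unread position \<open>j\<close>; row 1
  serves for the overwriting update, whence \<open>2 \<le> n\<close>.\<close>

lemma update_time_linear:
  assumes "2 \<le> n"
  shows "n \<le> Tu n * step_cost upd"
proof (rule ccontr)
  assume less: "\<not> n \<le> Tu n * step_cost upd"
  let ?W = "word_bound w n" and ?X = "set_row (\<lambda>i j. False) 0 (\<lambda>j. True)"
  let ?zero = "\<lambda>i j :: nat. False"
  let ?z = "\<lambda>j :: nat. False"
  let ?args = "\<lambda>r v s. load ARGS [n, rgt, r] (load IN1 (vec_cells n v) s)"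
  from init[of n] obtain m where "R n ?zero ?zero m" by blast
  moreover obtain m' k where
    "run ?W upd (load ARGS [n, lft, 0] (load IN1 (vec_cells n (\<lambda>j. True)) m)) k m'"
    using lft_halts[OF calculation, of 0 "\<lambda>j. True"] assms unfolding halts_within_def by auto
  ultimately have m': "R n ?X ?zero m'"
    using lft_step assms by (metis zero_less_numeral less_le_trans)
  then obtain k u where k: "k \<le> Tu n" and u: "run ?W upd (?args 0 ?z m') k u"
    using rgt_halts[OF m', of 0 ?z] assms unfolding halts_within_def by auto
  obtain S where S: "finite S" "card S \<le> k * step_cost upd" "depends_on ?W upd (?args 0 ?z m') k u S"
    using few_cells_read[OF u] by blast
  have "card S < card ((\<lambda>j. (IN1, j)) ` {..<n})"
  proof -
    have "card S \<le> Tu n * step_cost upd" using S(2) k by (meson mult_le_mono1 order_trans)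
    then show ?thesis using less by (simp add: card_image inj_on_def)
  qed
  then obtain j where j: "j < n" "(IN1, j) \<notin> S"
    using S(1) by (metis (no_types, lifting) card_mono image_subset_iff lessThan_iff not_le)
  let ?v = "\<lambda>i. i = j"
  have "agree S (?args 0 ?z m') (?args 0 ?v m')"
    using j(2) by (auto simp: agree_def load_def)
  then obtain u' where u': "run ?W upd (?args 0 ?v m') k u'"
    "parallel (?args 0 ?z m') u (?args 0 ?v m') u'"
    using S(3) unfolding depends_on_def by blast
  have Y: "R n ?X (set_row ?zero 0 ?z) u" "R n ?X (set_row ?zero 0 ?v) u'"
    using rgt_step[OF m' _ u] rgt_step[OF m' _ u'(1)] assms by auto
  have "u' a i = u a i" if "(a, i) \<noteq> (IN1, j)" for a i
  proof -
    have "?args 0 ?v m' a i = ?args 0 ?z m' a i" using that by (auto simp: load_def)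
    then show ?thesis using u'(2) unfolding parallel_def by metis
  qed
  \<comment> \<open>The only possible difference is the cell \<open>(IN1, j)\<close>, and
    \<open>j < n\<close> lies within the n cells that are loaded.\<close>
  then have same: "?args 1 ?z u' = ?args 1 ?z u"
    using j(1) by (auto simp: load_def fun_eq_iff)
  obtain k' m'' where m'': "run ?W upd (?args 1 ?z u) k' m''"
    using rgt_halts[OF Y(1), of 1 ?z] assms unfolding halts_within_def by auto
  have "R n ?X (set_row (set_row ?zero 0 ?z) 1 ?z) m''" "R n ?X (set_row (set_row ?zero 0 ?v) 1 ?z) m''"
    using rgt_step[OF Y(1) _ m''] rgt_step[OF Y(2), of 1 ?z] m'' same assms by auto
  \<comment> \<open>The memory \<open>m''\<close> represents both products, and by determinism the
    two promised answers are found in one final memory.\<close>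
  from this[THEN query, OF j(1)] obtain t where
    "holds_vec t OUT n (mat_col (bmult n ?X (set_row (set_row ?zero 0 ?z) 1 ?z)) j)"
    "holds_vec t OUT n (mat_col (bmult n ?X (set_row (set_row ?zero 0 ?v) 1 ?z)) j)"
    unfolding halts_within_def using run_deterministic by blast
  then have t:
    "t OUT 0 = of_bool (mat_col (bmult n ?X (set_row (set_row ?zero 0 ?z) 1 ?z)) j 0)"
    "t OUT 0 = of_bool (mat_col (bmult n ?X (set_row (set_row ?zero 0 ?v) 1 ?z)) j 0)"
    using assms unfolding holds_vec_def by auto
  have "\<not> mat_col (bmult n ?X (set_row (set_row ?zero 0 ?z) 1 ?z)) j 0"
    by (simp add: mat_col_def bmult_def set_row_def)
  moreover have "mat_col (bmult n ?X (set_row (set_row ?zero 0 ?v) 1 ?z)) j 0"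
    using assms by (auto simp: mat_col_def bmult_def set_row_def intro!: exI[of _ 0])
  ultimately show False
    using t by (metis of_bool_eq_iff)
qed

end


section \<open>The reduction\<close>

text \<open>The programs are fixed for all n, so dimensions enter as cells of \<open>ARGS\<close>: n
  in cell 0, t in cell 1. Phase 3 fetches the column index from cell 2 in the same way.\<close>

definition dim_expr :: "nat \<Rightarrow> expr" where
  "dim_expr x = Read ARGS (Const x)"

text \<open>
  The renamed update program has its arrays \<open>ARGS\<close> and \<open>IN1\<close> at 4 and 5. The multiplication by the
  test fills the row up with zeros to n columns. The row number is the loop counter of
  \<open>insert_rows\<close> in cell 0 of array 2.
\<close>

definition insert_row :: "nat \<Rightarrow> expr \<Rightarrow> prog \<Rightarrow> prog" where
  "insert_row side width upd =
     Seq (for_loop 1 (dim_expr 0)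
       (Write 5 (Read 2 (Const 1))
         (Bin Mul (Bin Less (Read 2 (Const 1)) width)
            (Read IN1 (Bin Add (Bin Mul (Read 2 (Const 0)) width) (Read 2 (Const 1)))))))
     (Seq (Write 4 (Const 0) (dim_expr 0))
     (Seq (Write 4 (Const 1) (Const side))
     (Seq (Write 4 (Const 2) (Read 2 (Const 0)))
       (rename shift upd))))"

definition insert_rows :: "nat \<Rightarrow> expr \<Rightarrow> expr \<Rightarrow> prog \<Rightarrow> prog" where
  "insert_rows side height width upd = for_loop 0 height (insert_row side width upd)"

definition phase1 :: "nat \<Rightarrow> prog \<Rightarrow> prog \<Rightarrow> prog" where
  "phase1 side pre upd = Seq (Seq (Write 4 (Const 0) (dim_expr 0)) (rename shift pre))
     (insert_rows side (dim_expr 0) (dim_expr 1) upd)"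

definition phase2 :: "nat \<Rightarrow> prog \<Rightarrow> prog" where
  "phase2 side upd = insert_rows side (dim_expr 1) (dim_expr 0) upd"

definition phase3 :: "prog \<Rightarrow> prog" where
  "phase3 qry = Seq (Write 4 (Const 0) (dim_expr 0))
     (Seq (Write 4 (Const 1) (dim_expr 2)) (rename shift qry))"

section \<open>Padded matrices and their insertion row by row\<close>

definition prefix_rows :: "nat \<Rightarrow> nat \<Rightarrow> bmat \<Rightarrow> bmat" where
  "prefix_rows h q A = (\<lambda>i j. i < h \<and> j < q \<and> A i j)"

definition pad_row :: "nat \<Rightarrow> bmat \<Rightarrow> nat \<Rightarrow> bvec" where
  "pad_row q A r = (\<lambda>j. j < q \<and> A r j)"

lemma set_row_prefix_rows: "set_row (prefix_rows r q A) r (pad_row q A r) = prefix_rows (Suc r) q A"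
  by (auto simp: set_row_def prefix_rows_def pad_row_def fun_eq_iff)

text \<open>The copying loop also reads beyond column \<open>q\<close>, before the test multiplies
  the value by zero. A value that does not fit into a word would block the run, hence the bound on
  all cells.\<close>

definition input_ok :: "nat \<Rightarrow> nat \<Rightarrow> bmat \<Rightarrow> (nat \<Rightarrow> nat) \<Rightarrow> bool" where
  "input_ok p q A D \<longleftrightarrow> (\<forall>k. D k \<le> 1) \<and> (\<forall>i<p. \<forall>j<q. D (i * q + j) = of_bool (A i j))"

lemma input_ok_load:
  assumes "\<And>k. s IN1 k \<le> 1"
  shows "input_ok p q A (load IN1 (mat_cells p q A) s IN1)"
proof -
  have "i * q + j < p * q" if "i < p" "j < q" for i j
  proof -
    have "Suc i * q \<le> p * q" using that by (intro mult_le_mono1) simp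
    then show ?thesis using that by simp
  qed
  then show ?thesis
    using assms by (auto simp: input_ok_def load_def mat_cells_def)
qed

text \<open>\<open>n * n + n\<close> exceeds every address \<open>r * q + k\<close> of the copying
  loop, and 8 leaves room for bits and literals.\<close>

definition dims_ok :: "nat \<Rightarrow> nat \<Rightarrow> nat \<Rightarrow> bool" where
  "dims_ok n t W \<longleftrightarrow> t \<le> n \<and> n * n + n < W \<and> 8 \<le> W"

text \<open>The loop with its one-step body takes \<open>3 * n + 2\<close> steps, the three scalar
  arguments take 3, and the call takes \<open>c\<close>.\<close>

lemma halts_within_insert_row:
  assumes W: "dims_ok n t W'" "W \<le> W'" "side < 2"
    and dims: "s ARGS 0 = n" "s ARGS d = q" "d < 2" "q \<le> n"
    and inp: "input_ok p q A (s IN1)"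
    and r: "s 2 0 = r" "r < p" "r < n"
    and upd: "halts_within W upd
      (load ARGS [n, side, r] (load IN1 (vec_cells n (pad_row q A r)) (s \<circ> shift))) c m"
  shows "\<exists>u. halts_within W' (insert_row side (dim_expr d) upd) s (3 * n + 5 + c) u \<and>
    u \<circ> shift = m \<and> u ARGS = s ARGS \<and> u IN1 = s IN1 \<and> u 2 0 = r"
proof -
  let ?v = "pad_row q A r"
  \<comment> \<open>The invariant determines the entire memory, because the call requires the view
    through \<open>shift\<close> to equal the loaded memory exactly, including the cells from n
    on.\<close>
  define I where "I k u \<longleftrightarrow> u = s(2 := (s 2)(1 := k),
    5 := (\<lambda>i. if i < k then of_bool (?v i) else s 5 i))" for k u
  let ?copy = "Write 5 (Read 2 (Const 1))
         (Bin Mul (Bin Less (Read 2 (Const 1)) (dim_expr d))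
            (Read IN1 (Bin Add (Bin Mul (Read 2 (Const 0)) (dim_expr d)) (Read 2 (Const 1)))))"
  have small: "n < W'" "q < W'" "r < W'" "r * q + k < W'" "r * q < W'" if "k < n" for k
  proof -
    have "r * q \<le> n * n" using r(3) dims(4) by (intro mult_le_mono) auto
    then show "n < W'" "q < W'" "r < W'" "r * q + k < W'" "r * q < W'"
      using W(1) that r(3) dims(4) unfolding dims_ok_def by auto
  qed
  have "\<exists>u. halts_within W' (for_loop 1 (dim_expr 0) ?copy) s (n * (1 + 2) + 2) u \<and> I n u"
  proof (rule halts_within_for_loop)
    fix k u assume k: "k < n" and I: "I k u"
    let ?u = "u(5 := (u 5)(k := of_bool (?v k)))"
    have u: "u ARGS = s ARGS" "u IN1 = s IN1" "u 2 0 = r" "u 2 1 = k"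
      using I r unfolding I_def by auto
    have "s IN1 (r * q + k) < W'"
      using inp W(1) unfolding input_ok_def dims_ok_def
      by (meson le_less_trans less_le_trans one_less_numeral_iff semiring_norm(76))
    moreover have "of_bool (k < q) * s IN1 (r * q + k) = of_bool (?v k)"
      using inp r(2) unfolding input_ok_def pad_row_def by auto
    moreover have "of_bool b < W'" for b using W(1) by (auto simp: dims_ok_def)
    ultimately have "halts_within W' ?copy u 1 ?u"
      using small[OF k] k W(1) dims
      by (intro halts_within_Write) (auto simp: u[unfolded One_nat_def] fit_def dim_expr_def dims_ok_def)
    moreover have "I (Suc k) (?u(2 := (?u 2)(1 := Suc k)))"
      using I unfolding I_def by (auto simp: fun_eq_iff less_Suc_eq)
    moreover have "?u 2 1 = k" using u by simp
    ultimately show "\<exists>u'. halts_within W' ?copy u 1 u' \<and> u' 2 1 = k \<and>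
        I (Suc k) (u'(2 := (u' 2)(1 := Suc k)))" by blast
  next
    show "u 2 1 = k \<and> eval W' u (dim_expr 0) = Some n" if "k \<le> n" "I k u" for k u
      using that W(1) dims(1) unfolding I_def by (auto simp: dim_expr_def fit_def dims_ok_def)
  next
    show "I 0 (s(2 := (s 2)(1 := 0)))" unfolding I_def by (auto simp: fun_eq_iff)
  qed (use W(1) in \<open>auto simp: dims_ok_def\<close>)
  then obtain u where u: "halts_within W' (for_loop 1 (dim_expr 0) ?copy) s (n * (1 + 2) + 2) u" "I n u"
    by blast
  let ?u1 = "u(4 := (u 4)(0 := n))"
  let ?u2 = "?u1(4 := (?u1 4)(1 := side))"
  let ?u3 = "?u2(4 := (?u2 4)(2 := r))"
  have uv: "u ARGS = s ARGS" "u IN1 = s IN1" "u 2 0 = r"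
    using u(2) r unfolding I_def by auto
  have w1: "halts_within W' (Write 4 (Const 0) (dim_expr 0)) u 1 ?u1"
    using W(1) dims by (intro halts_within_Write) (auto simp: uv fit_def dim_expr_def dims_ok_def)
  have w2: "halts_within W' (Write 4 (Const 1) (Const side)) ?u1 1 ?u2"
    using W(1,3) by (intro halts_within_Write) (auto simp: fit_def dims_ok_def)
  have w3: "halts_within W' (Write 4 (Const 2) (Read 2 (Const 0))) ?u2 1 ?u3"
    using W(1) small[OF r(3)] by (intro halts_within_Write) (auto simp: uv fit_def dims_ok_def)
  have "?u3 \<circ> shift = load ARGS [n, side, r] (load IN1 (vec_cells n ?v) (s \<circ> shift))"
    using u(2) unfolding I_def
    by (auto simp: fun_eq_iff load_def shift_def nth_Cons numeral_2_eq_2 less_Suc_eq split: nat.splits)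
  with upd have "halts_within W upd (?u3 \<circ> shift) c m" by simp
  from halts_within_rename[OF inj_shift this W(2)] obtain u4 where
    u4: "halts_within W' (rename shift upd) ?u3 c u4" "m = u4 \<circ> shift" "\<forall>b. b \<notin> range shift \<longrightarrow> u4 b = ?u3 b"
    by blast
  have "halts_within W' (insert_row side (dim_expr d) upd) s (n * (1 + 2) + 2 + (1 + (1 + (1 + c)))) u4"
    unfolding insert_row_def
    by (rule halts_within_Seq[OF u(1) halts_within_Seq[OF w1 halts_within_Seq[OF w2
          halts_within_Seq[OF w3 u4(1)]]]])
  moreover have "u4 b = u b" if "b < 3" for b
    using u4(3) low_notin_range_shift[OF that] that by simp
  then have "u4 ARGS = s ARGS" "u4 IN1 = s IN1" "u4 2 0 = r" using uv by simp_all
  moreover have "n * (1 + 2) + 2 + (1 + (1 + (1 + c))) = 3 * n + 5 + c" by simp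
  ultimately show ?thesis using u4(2) by metis
qed

text \<open>\<open>G r\<close> describes the private memory after r insertions; being abstract, it
  serves both factors. Counter updates do not affect it, as array 2 is invisible through
  \<open>shift\<close>. The constant 7 is 5 from a single insertion plus 2 for the test and the
  increment.\<close>

lemma halts_within_insert_rows:
  assumes W: "dims_ok n t W'" "W \<le> W'" "side < 2"
    and dims: "s ARGS 0 = n" "s ARGS d = q" "d < 2" "q \<le> n" "s ARGS e = p" "e < 2" "p \<le> n"
    and inp: "input_ok p q A (s IN1)"
    and G0: "G 0 (s \<circ> shift)"
    and G: "\<And>r m. r < p \<Longrightarrow> G r m \<Longrightarrow> \<exists>m'. halts_within W upd
      (load ARGS [n, side, r] (load IN1 (vec_cells n (pad_row q A r)) m)) c m' \<and> G (Suc r) m'"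
  shows "\<exists>u. halts_within W' (insert_rows side (dim_expr e) (dim_expr d) upd) s
      (p * (3 * n + 7 + c) + 2) u \<and> G p (u \<circ> shift) \<and> u IN1 = s IN1"
proof -
  have shift_upd: "u(2 := f) \<circ> shift = u \<circ> shift" for u :: memory and f
    by (auto simp: fun_eq_iff shift_def)
  define I where "I r u \<longleftrightarrow> u ARGS = s ARGS \<and> u IN1 = s IN1 \<and> u 2 0 = r \<and> G r (u \<circ> shift)" for r u
  have "\<exists>u. halts_within W' (for_loop 0 (dim_expr e) (insert_row side (dim_expr d) upd)) s
      (p * ((3 * n + 5 + c) + 2) + 2) u \<and> I p u"
  proof (rule halts_within_for_loop)
    fix r u assume r: "r < p" and I: "I r u"
    obtain m where m: "halts_within W upd
      (load ARGS [n, side, r] (load IN1 (vec_cells n (pad_row q A r)) (u \<circ> shift))) c m" "G (Suc r) m"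
      using G[OF r] I unfolding I_def by blast
    have "\<exists>u'. halts_within W' (insert_row side (dim_expr d) upd) u (3 * n + 5 + c) u' \<and>
        u' \<circ> shift = m \<and> u' ARGS = u ARGS \<and> u' IN1 = u IN1 \<and> u' 2 0 = r"
      using I r dims inp unfolding I_def by (intro halts_within_insert_row[OF W _ _ _ _ _ _ _ _ m(1)]) auto
    then obtain u' where u': "halts_within W' (insert_row side (dim_expr d) upd) u (3 * n + 5 + c) u'"
      "u' \<circ> shift = m" "u' ARGS = u ARGS" "u' IN1 = u IN1" "u' 2 0 = r" by blast
    have "I (Suc r) (u'(2 := (u' 2)(0 := Suc r)))"
      using u' m(2) I unfolding I_def shift_upd by auto
    with u' show "\<exists>u'. halts_within W' (insert_row side (dim_expr d) upd) u (3 * n + 5 + c) u' \<and>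
      u' 2 0 = r \<and> I (Suc r) (u'(2 := (u' 2)(0 := Suc r)))" by blast
  next
    show "u 2 0 = r \<and> eval W' u (dim_expr e) = Some p" if "r \<le> p" "I r u" for r u
      using that W(1) dims unfolding I_def by (auto simp: dim_expr_def fit_def dims_ok_def)
  next
    show "I 0 (s(2 := (s 2)(0 := 0)))" using G0 unfolding I_def shift_upd by simp
  qed (use W(1) dims in \<open>auto simp: dims_ok_def\<close>)
  moreover have "p * ((3 * n + 5 + c) + 2) + 2 = p * (3 * n + 7 + c) + 2" by simp
  ultimately show ?thesis unfolding insert_rows_def I_def by metis
qed

lemma word_bound_mono: "v \<le> w \<Longrightarrow> word_bound v n \<le> word_bound w n"
  unfolding word_bound_def by (intro power_increasing) auto

text \<open>The exponent \<open>w + 3\<close> dominates \<open>w\<close>, for the simulated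
  algorithm, and 3, for the surrounding program: \<open>(n + 2) ^ 3\<close> is at least 8 and
  exceeds \<open>n * n + n\<close>.\<close>

lemma dims_ok_word_bound:
  assumes "t \<le> n"
  shows "dims_ok n t (word_bound (w + 3) n)"
proof -
  have "word_bound 3 n \<le> word_bound (w + 3) n" by (rule word_bound_mono) simp
  moreover have "8 \<le> word_bound 3 n" "n * n + n < word_bound 3 n"
    by (auto simp: word_bound_def power3_eq_cube algebra_simps)
  ultimately show ?thesis using assms by (auto simp: dims_ok_def)
qed

lemma dim_pow_le:
  assumes "0 < \<tau>" "\<tau> < 1"
  shows "dim_pow n \<tau> \<le> n"
proof (cases "n = 0")
  case False
  then have "real n powr \<tau> \<le> real n powr 1" using assms by (intro powr_mono) auto
  then have "real n powr \<tau> \<le> real n" using False by simp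
  then show ?thesis by (simp add: dim_pow_def)
qed (simp add: dim_pow_def)

section \<open>Correctness of the three phases\<close>

context dynamic_rows
begin

lemma lft_insert:
  assumes "R n (prefix_rows r q A) Y s" "r < n"
  shows "\<exists>s'. halts_within (word_bound w n) upd
    (load ARGS [n, lft, r] (load IN1 (vec_cells n (pad_row q A r)) s)) (Tu n) s' \<and>
    R n (prefix_rows (Suc r) q A) Y s'"
  using lft_halts[OF assms] lft_step[OF assms] unfolding halts_within_def
  by (metis set_row_prefix_rows)

lemma rgt_insert:
  assumes "R n X (prefix_rows r q A) s" "r < n"
  shows "\<exists>s'. halts_within (word_bound w n) upd
    (load ARGS [n, rgt, r] (load IN1 (vec_cells n (pad_row q A r)) s)) (Tu n) s' \<and>
    R n X (prefix_rows (Suc r) q A) s'"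
  using rgt_halts[OF assms] rgt_step[OF assms] unfolding halts_within_def
  by (metis set_row_prefix_rows)

lemma prefix_rows_0: "prefix_rows 0 q A = (\<lambda>i j. False)"
  by (simp add: prefix_rows_def)

text \<open>The bound on \<open>IN1\<close> is handed on to phase 2, whose input is loaded over the
  old contents of this array.\<close>

lemma phase1_correct:
  assumes "t \<le> n"
  defines "W \<equiv> word_bound (w + 3) n"
  shows "\<exists>s. halts_within W (phase1 lft pre upd)
      (load ARGS [n, t] (load IN1 (mat_cells n t M) blank))
      (Tp n + n * (3 * n + 7 + Tu n) + 3) s \<and>
    R n (prefix_rows n t M) (\<lambda>i j. False) (s \<circ> shift) \<and> (\<forall>k. s IN1 k \<le> 1)"
proof -
  let ?s = "load ARGS [n, t] (load IN1 (mat_cells n t M) blank)"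
  let ?s1 = "?s(4 := (?s 4)(0 := n))"
  have W: "dims_ok n t W" "word_bound w n \<le> W"
    unfolding W_def using assms dims_ok_word_bound word_bound_mono by auto
  have w: "halts_within W (Write 4 (Const 0) (dim_expr 0)) ?s 1 ?s1"
    using W(1) by (intro halts_within_Write) (auto simp: fit_def dim_expr_def load_def dims_ok_def)
  have "?s1 \<circ> shift = load ARGS [n] blank"
    by (auto simp: fun_eq_iff load_def shift_def blank_def)
  with init[of n] obtain m where
    m: "halts_within (word_bound w n) pre (?s1 \<circ> shift) (Tp n) m" "R n (\<lambda>i j. False) (\<lambda>i j. False) m"
    by auto
  from halts_within_rename[OF inj_shift m(1) W(2)] obtain u where
    u: "halts_within W (rename shift pre) ?s1 (Tp n) u" "m = u \<circ> shift" "\<forall>b. b \<notin> range shift \<longrightarrow> u b = ?s1 b"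
    by blast
  have uv: "u ARGS = ?s ARGS" "u IN1 = ?s IN1"
    using u(3) by (simp_all add: low_notin_range_shift)
  have inp: "input_ok n t M (u IN1)"
    unfolding uv using input_ok_load[of blank n t M] by (simp add: load_def blank_def)
  have "\<exists>u'. halts_within W (insert_rows lft (dim_expr 0) (dim_expr 1) upd) u
      (n * (3 * n + 7 + Tu n) + 2) u' \<and> R n (prefix_rows n t M) (\<lambda>i j. False) (u' \<circ> shift) \<and>
      u' IN1 = u IN1"
  proof (rule halts_within_insert_rows[OF W sides(1), where p = n and q = t
        and G = "\<lambda>r. R n (prefix_rows r t M) (\<lambda>i j. False)"])
    show "R n (prefix_rows 0 t M) (\<lambda>i j. False) (u \<circ> shift)"
      using m(2) u(2) by (simp add: prefix_rows_0)
    show "u ARGS 0 = n" "u ARGS 1 = t" unfolding uv by (simp_all add: load_def)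
    show "\<exists>m'. halts_within (word_bound w n) upd
        (load ARGS [n, lft, r] (load IN1 (vec_cells n (pad_row t M r)) m)) (Tu n) m' \<and>
        R n (prefix_rows (Suc r) t M) (\<lambda>i j. False) m'"
      if "r < n" "R n (prefix_rows r t M) (\<lambda>i j. False) m" for r m
      using that by (intro lft_insert)
  qed (use assms(1) inp in \<open>auto simp: uv(1) load_def\<close>)
  then obtain u' where u': "halts_within W (insert_rows lft (dim_expr 0) (dim_expr 1) upd) u
      (n * (3 * n + 7 + Tu n) + 2) u'" "R n (prefix_rows n t M) (\<lambda>i j. False) (u' \<circ> shift)"
      "u' IN1 = u IN1" by blast
  have "halts_within W (phase1 lft pre upd) ?s ((1 + Tp n) + (n * (3 * n + 7 + Tu n) + 2)) u'"
    unfolding phase1_def by (rule halts_within_Seq[OF halts_within_Seq[OF w u(1)] u'(1)])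
  moreover have "(1 + Tp n) + (n * (3 * n + 7 + Tu n) + 2) = Tp n + n * (3 * n + 7 + Tu n) + 3" by simp
  moreover have "u' IN1 k \<le> 1" for k using u'(3) inp unfolding input_ok_def by simp
  ultimately show ?thesis using u'(2) by metis
qed

lemma phase2_correct:
  assumes "t \<le> n" and s: "R n X (\<lambda>i j. False) (s \<circ> shift)" "\<And>k. s IN1 k \<le> 1"
  defines "W \<equiv> word_bound (w + 3) n"
  shows "\<exists>u. halts_within W (phase2 rgt upd)
      (load ARGS [n, t] (load IN1 (mat_cells t n V) s)) (t * (3 * n + 7 + Tu n) + 2) u \<and>
    R n X (prefix_rows t n V) (u \<circ> shift)"
proof -
  let ?s = "load ARGS [n, t] (load IN1 (mat_cells t n V) s)"
  have W: "dims_ok n t W" "word_bound w n \<le> W"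
    unfolding W_def using assms dims_ok_word_bound word_bound_mono by auto
  have sh: "?s \<circ> shift = s \<circ> shift" by (auto simp: fun_eq_iff load_def shift_def)
  have inp: "input_ok t n V (?s IN1)"
    using input_ok_load[of s t n V] s(2) by (simp add: load_def)
  have "\<exists>u. halts_within W (insert_rows rgt (dim_expr 1) (dim_expr 0) upd) ?s
      (t * (3 * n + 7 + Tu n) + 2) u \<and> R n X (prefix_rows t n V) (u \<circ> shift) \<and> u IN1 = ?s IN1"
  proof (rule halts_within_insert_rows[OF W sides(2), where p = t and q = n
        and G = "\<lambda>r. R n X (prefix_rows r n V)"])
    show "R n X (prefix_rows 0 n V) (?s \<circ> shift)"
      unfolding sh using s(1) by (simp add: prefix_rows_0)
    show "?s ARGS 0 = n" "?s ARGS 1 = t" by (simp_all add: load_def)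
    show "\<exists>m'. halts_within (word_bound w n) upd
        (load ARGS [n, rgt, r] (load IN1 (vec_cells n (pad_row n V r)) m)) (Tu n) m' \<and>
        R n X (prefix_rows (Suc r) n V) m'"
      if "r < t" "R n X (prefix_rows r n V) m" for r m
      using that assms(1) by (intro rgt_insert) simp_all
  qed (use assms(1) inp in \<open>auto simp: load_def\<close>)
  then show ?thesis unfolding phase2_def by blast
qed

text \<open>The overhead is constant: \<open>shift\<close> fixes \<open>OUT\<close>, so the answer
  need not be copied.\<close>

lemma phase3_correct:
  assumes "t \<le> n" "i < n" and s: "R n X Y (s \<circ> shift)"
  defines "W \<equiv> word_bound (w + 3) n"
  shows "\<exists>u. halts_within W (phase3 qry) (load ARGS [n, t, i] s) (Tq n + 2) u \<and>
    holds_vec u OUT n (mat_col (bmult n X Y) i)"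
proof -
  let ?s = "load ARGS [n, t, i] s"
  let ?s1 = "?s(4 := (?s 4)(0 := n))"
  let ?s2 = "?s1(4 := (?s1 4)(1 := i))"
  have W: "dims_ok n t W" "word_bound w n \<le> W"
    unfolding W_def using assms dims_ok_word_bound word_bound_mono by auto
  have w1: "halts_within W (Write 4 (Const 0) (dim_expr 0)) ?s 1 ?s1"
    using W(1) by (intro halts_within_Write) (auto simp: fit_def dim_expr_def load_def dims_ok_def)
  have w2: "halts_within W (Write 4 (Const 1) (dim_expr 2)) ?s1 1 ?s2"
    using W(1) assms(2)
    by (intro halts_within_Write) (auto simp: fit_def dim_expr_def load_def dims_ok_def)
  have "?s2 \<circ> shift = load ARGS [n, i] (s \<circ> shift)"
    by (auto simp: fun_eq_iff load_def shift_def nth_Cons less_Suc_eq split: nat.splits)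
  with query[OF s assms(2)] obtain m where
    m: "halts_within (word_bound w n) qry (?s2 \<circ> shift) (Tq n) m"
       "holds_vec m OUT n (mat_col (bmult n X Y) i)" by auto
  from halts_within_rename[OF inj_shift m(1) W(2)] obtain u where
    u: "halts_within W (rename shift qry) ?s2 (Tq n) u" "m = u \<circ> shift" by blast
  have "halts_within W (phase3 qry) ?s (1 + (1 + Tq n)) u"
    unfolding phase3_def by (rule halts_within_Seq[OF w1 halts_within_Seq[OF w2 u(1)]])
  moreover have "holds_vec u OUT n (mat_col (bmult n X Y) i)"
    using m(2) unfolding u(2) by (simp add: holds_vec_def shift_def)
  ultimately show ?thesis by (intro exI[of _ u]) simp
qed

lemma solves_v_hinted_Mv_phases:
  assumes "0 < \<tau>" "\<tau> < 1"
  shows "solves_v_hinted_Mv \<tau> (w + 3) (phase1 lft pre upd) (phase2 rgt upd) (phase3 qry)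
    (\<lambda>n. Tp n + n * (3 * n + 7 + Tu n) + 3) (\<lambda>n. dim_pow n \<tau> * (3 * n + 7 + Tu n) + 2)
    (\<lambda>n. Tq n + 2)"
proof -
  have "\<exists>s1. halts_within (word_bound (w + 3) n) (phase1 lft pre upd)
          (load ARGS [n, t] (load IN1 (mat_cells n t M) blank))
          (Tp n + n * (3 * n + 7 + Tu n) + 3) s1 \<and>
        (\<forall>V. \<exists>s2. halts_within (word_bound (w + 3) n) (phase2 rgt upd)
            (load ARGS [n, t] (load IN1 (mat_cells t n V) s1)) (t * (3 * n + 7 + Tu n) + 2) s2 \<and>
          (\<forall>i<n. \<exists>s3. halts_within (word_bound (w + 3) n) (phase3 qry)
              (load ARGS [n, t, i] s2) (Tq n + 2) s3 \<and>
             holds_vec s3 OUT n (mat_col (bmult t M V) i)))"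
    if t: "t \<le> n" for n t M
  proof -
    \<comment> \<open>Inner indices from t on contribute nothing, since the padded factors vanish
      there.\<close>
    have prod: "holds_vec s OUT n (mat_col (bmult n (prefix_rows n t M) (prefix_rows t n V)) i) \<longleftrightarrow>
        holds_vec s OUT n (mat_col (bmult t M V) i)" if "i < n" for s V i
    proof -
      have "bmult n (prefix_rows n t M) (prefix_rows t n V) k i = bmult t M V k i" if "k < n" for k
        using that \<open>i < n\<close> t unfolding bmult_def prefix_rows_def by (meson less_le_trans)
      then show ?thesis by (simp add: holds_vec_def mat_col_def)
    qed
    show ?thesis
      using phase1_correct[OF t, of M] phase2_correct[OF t] phase3_correct[OF t] prod by meson
  qed
  then show ?thesis
    unfolding solves_v_hinted_Mv_def Let_def using dim_pow_le[OF assms] by blast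
qed

section \<open>Asymptotic running times\<close>

lemma poly_time_phase1:
  assumes "poly_time Tp" "time_exponent Tu x"
  shows "poly_time (\<lambda>n. Tp n + n * (3 * n + 7 + Tu n) + 3)"
proof -
  obtain d where d: "(\<lambda>n. real (Tp n)) \<in> O(\<lambda>n. real n ^ d)"
    using assms(1) unfolding poly_time_def by blast
  \<comment> \<open>The exponent has to cover \<open>d\<close>, then
    \<open>1 + nat \<lceil>x\<rceil>\<close> for n updates, and 2 for copying n rows.\<close>
  define e where "e = max d (nat \<lceil>x\<rceil> + 2)"
  have pow: "(\<lambda>n. real n ^ a) \<in> O(\<lambda>n. real n ^ b)" if "a \<le> b" for a b
    using that by (intro landau_o.big_mono) (auto intro!: eventually_sequentiallyI[of 1] power_increasing)
  have "(\<lambda>n. real n powr x) \<in> O(\<lambda>n. real n ^ nat \<lceil>x\<rceil>)"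
  proof (rule landau_o.big_mono, rule eventually_sequentiallyI[of 1])
    fix n :: nat assume n: "1 \<le> n"
    have "x \<le> real (nat \<lceil>x\<rceil>)" by linarith
    then have "real n powr x \<le> real n powr real (nat \<lceil>x\<rceil>)" using n by (intro powr_mono) auto
    then show "norm (real n powr x) \<le> norm (real n ^ nat \<lceil>x\<rceil>)" using n by (simp add: powr_realpow)
  qed
  then have "(\<lambda>n. real (Tu n)) \<in> O(\<lambda>n. real n ^ nat \<lceil>x\<rceil>)"
    using assms(2) unfolding time_exponent_def by (rule landau_o.big_trans[rotated])
  then have "(\<lambda>n. real n ^ 1 * real (Tu n)) \<in> O(\<lambda>n. real n ^ 1 * real n ^ nat \<lceil>x\<rceil>)"
    by (rule landau_o.big.mult_left)
  also have "(\<lambda>n. real n ^ 1 * real n ^ nat \<lceil>x\<rceil>) = (\<lambda>n. real n ^ (1 + nat \<lceil>x\<rceil>))"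
    by (simp add: fun_eq_iff)
  also have "(\<lambda>n. real n ^ (1 + nat \<lceil>x\<rceil>)) \<in> O(\<lambda>n. real n ^ e)"
    by (rule pow) (simp add: e_def)
  finally have "(\<lambda>n. real n * real (Tu n)) \<in> O(\<lambda>n. real n ^ e)" by simp
  moreover have "(\<lambda>n. real (Tp n)) \<in> O(\<lambda>n. real n ^ e)"
    using d pow[of d e] landau_o.big_trans by (auto simp: e_def)
  moreover have "(\<lambda>n. 3 * real n ^ 2) \<in> O(\<lambda>n. real n ^ e)" "(\<lambda>n. 7 * real n ^ 1) \<in> O(\<lambda>n. real n ^ e)"
    "(\<lambda>n. 3 * real n ^ 0) \<in> O(\<lambda>n. real n ^ e)"
    using pow[of 2 e] pow[of 1 e] pow[of 0 e] by (simp_all add: e_def)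
  ultimately have "(\<lambda>n. real (Tp n) + real n * real (Tu n) + 3 * real n ^ 2 + 7 * real n ^ 1 + 3 * real n ^ 0)
      \<in> O(\<lambda>n. real n ^ e)"
    by (intro sum_in_bigo)
  then show ?thesis
    unfolding poly_time_def by (intro exI[of _ e]) (simp add: algebra_simps power2_eq_square)
qed

text \<open>Rounding up adds less than 1, which is at most \<open>real n powr \<tau>\<close> for
  positive n; hence the factor 2.\<close>

lemma dim_pow_bigo:
  assumes "0 < \<tau>"
  shows "(\<lambda>n. real (dim_pow n \<tau>)) \<in> O(\<lambda>n. real n powr \<tau>)"
proof (rule bigoI[where c = 2], rule eventually_sequentiallyI[of 1])
  fix n :: nat assume "1 \<le> n"
  then have "1 \<le> real n powr \<tau>" using assms by (intro ge_one_powr_ge_zero) auto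
  then have "real (dim_pow n \<tau>) \<le> 2 * real n powr \<tau>" unfolding dim_pow_def by linarith
  then show "norm (real (dim_pow n \<tau>)) \<le> 2 * norm (real n powr \<tau>)" by simp
qed

text \<open>By \<open>update_time_linear\<close> the copying cost is a multiple of the update time,
  so no relation between \<open>x\<close> and 1 is needed.\<close>

lemma time_exponent_phase2:
  assumes "0 < \<tau>" "time_exponent Tu x"
  shows "time_exponent (\<lambda>n. dim_pow n \<tau> * (3 * n + 7 + Tu n) + 2) (\<tau> + x)"
proof -
  let ?c = "step_cost upd"
  have "(\<lambda>n. real (dim_pow n \<tau> * (3 * n + 7 + Tu n) + 2)) \<in> O(\<lambda>n. real (dim_pow n \<tau>) * real (Tu n))"
  \<comment> \<open>\<open>3 * ?c\<close> pays for \<open>3 * n\<close>, 8 for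
    \<open>7 + Tu n\<close>, and 2 for the constant outside the product, as \<open>?t * Tu n\<close>
    is at least 1.\<close>
  proof (rule bigoI[where c = "3 * ?c + 10"], rule eventually_sequentiallyI[of 2])
    fix n :: nat assume n: "2 \<le> n"
    let ?t = "dim_pow n \<tau>"
    have lin: "n \<le> Tu n * ?c" using update_time_linear[OF n] .
    then have "Tu n \<noteq> 0" using n by (cases "Tu n") auto
    moreover have "0 < ?t"
    proof -
      have "0 < real n powr \<tau>" using n by simp
      then show ?thesis unfolding dim_pow_def by simp
    qed
    ultimately have "1 \<le> ?t * Tu n" "1 \<le> Tu n" by (simp_all add: Suc_le_eq)
    moreover from lin \<open>1 \<le> Tu n\<close> have "3 * n + 7 + Tu n \<le> (3 * ?c + 8) * Tu n"
      by (simp add: algebra_simps)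
    then have "?t * (3 * n + 7 + Tu n) \<le> ?t * ((3 * ?c + 8) * Tu n)" by (rule mult_le_mono2)
    then have "?t * (3 * n + 7 + Tu n) \<le> (3 * ?c + 8) * (?t * Tu n)" by (simp only: ac_simps)
    moreover have "(3 * ?c + 10) * (?t * Tu n) = (3 * ?c + 8) * (?t * Tu n) + 2 * (?t * Tu n)"
      by (simp add: algebra_simps)
    ultimately have "?t * (3 * n + 7 + Tu n) + 2 \<le> (3 * ?c + 10) * (?t * Tu n)"
      by linarith
    then have "real (?t * (3 * n + 7 + Tu n) + 2) \<le> real ((3 * ?c + 10) * (?t * Tu n))"
      by (rule of_nat_mono)
    then show "norm (real (?t * (3 * n + 7 + Tu n) + 2)) \<le>
        (3 * ?c + 10) * norm (real ?t * real (Tu n))" by simp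
  qed
  also have "(\<lambda>n. real (dim_pow n \<tau>) * real (Tu n)) \<in> O(\<lambda>n. real n powr \<tau> * real n powr x)"
    using dim_pow_bigo[OF assms(1)] assms(2) unfolding time_exponent_def by (rule landau_o.big.mult)
  finally show ?thesis unfolding time_exponent_def by (simp add: powr_add)
qed

end

lemma time_exponent_mono:
  assumes "time_exponent T x" "x \<le> y"
  shows "time_exponent T y"
proof -
  have "(\<lambda>n. real n powr x) \<in> O(\<lambda>n. real n powr y)"
    using assms(2) by (intro landau_o.big_mono)
      (auto intro!: eventually_sequentiallyI[of 1] powr_mono)
  then show ?thesis using assms(1) unfolding time_exponent_def by (rule landau_o.big_trans[rotated])
qed

lemma time_exponent_add_const:
  assumes "time_exponent T x" "0 \<le> x"
  shows "time_exponent (\<lambda>n. T n + c) x"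
proof -
  have "time_exponent (\<lambda>n. c) 0"
    unfolding time_exponent_def
    by (rule bigoI[where c = "real c"], rule eventually_sequentiallyI[of 1]) simp
  then have "time_exponent (\<lambda>n. c) x" using assms(2) by (rule time_exponent_mono)
  then show ?thesis using assms(1) unfolding time_exponent_def by (simp add: sum_in_bigo)
qed

section \<open>Contradiction to the conjecture\<close>

lemma dynamic_rows_contradiction:
  assumes conj: "v_hinted_Mv_conjecture" and par: "0 < \<tau>" "\<tau> < 1" "0 < \<epsilon>"
    and dyn: "dynamic_rows w pre upd qry Tp Tu Tq lft rgt R"
    and times: "poly_time Tp" "time_exponent Tu (omega 1 1 \<tau> - \<tau> - \<epsilon>)"
      "time_exponent Tq (1 + \<tau> - \<epsilon>)"
  shows False
proof -
  interpret dynamic_rows w pre upd qry Tp Tu Tq lft rgt R by (rule dyn)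
  text \<open>Keeps the exponent of phase 3 nonnegative, so that its constant overhead is absorbed.\<close>
  define \<delta> where "\<delta> = min \<epsilon> \<tau>"
  have \<delta>: "0 < \<delta>" "\<delta> \<le> \<epsilon>" "\<delta> \<le> \<tau>" using par by (auto simp: \<delta>_def)
  \<comment> \<open>The exponent \<open>\<tau>\<close> of the number of updates cancels the
    \<open>- \<tau>\<close> in the exponent of a single update.\<close>
  have "time_exponent (\<lambda>n. dim_pow n \<tau> * (3 * n + 7 + Tu n) + 2) (omega 1 1 \<tau> - \<delta>)"
    by (rule time_exponent_mono[OF time_exponent_phase2[OF par(1) times(2)]]) (use \<delta>(2) in simp)
  moreover have "time_exponent (\<lambda>n. Tq n + 2) (1 + \<tau> - \<delta>)"
    using \<delta> by (intro time_exponent_add_const time_exponent_mono[OF times(3)]) auto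
  ultimately show False
    using conj solves_v_hinted_Mv_phases[OF par(1,2)] poly_time_phase1[OF times(1,2)] par(1,2) \<delta>(1)
    unfolding v_hinted_Mv_conjecture_def by blast
qed

lemma no_dynamic_product:
  assumes "v_hinted_Mv_conjecture" "0 < \<tau>" "\<tau> < 1" "0 < \<epsilon>"
  shows "\<not> dynamic_product_algorithm set_row mat_col (omega 1 1 \<tau> - \<tau> - \<epsilon>) (1 + \<tau> - \<epsilon>)"
    and "\<not> dynamic_product_algorithm set_col mat_row (omega 1 1 \<tau> - \<tau> - \<epsilon>) (1 + \<tau> - \<epsilon>)"
  unfolding dynamic_product_algorithm_def
  using dynamic_rows_contradiction[OF assms dynamic_rows_of_set_row]
    dynamic_rows_contradiction[OF assms dynamic_rows_of_set_col] by (metis, metis)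

theorem theorem5p3:
  assumes "v_hinted_Mv_conjecture"
  shows
    "(\<forall>\<tau> \<epsilon> :: real. 0 < \<tau> \<and> \<tau> < 1 \<and> 0 < \<epsilon> \<longrightarrow>
        \<not> dynamic_product_algorithm set_row mat_col (omega 1 1 \<tau> - \<tau> - \<epsilon>) (1 + \<tau> - \<epsilon>)) \<and>
     (\<forall>\<tau> \<epsilon> :: real. 0 < \<tau> \<and> \<tau> < 1 \<and> 0 < \<epsilon> \<longrightarrow>
        \<not> dynamic_product_algorithm set_col mat_row (omega 1 1 \<tau> - \<tau> - \<epsilon>) (1 + \<tau> - \<epsilon>)) \<and>
     (\<forall>\<tau> :: real. 0.528 < \<tau> \<and> \<tau> < 1 \<and> omega 1 1 \<tau> - \<tau> = 1 + \<tau> \<longrightarrow>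
        \<not> dynamic_product_algorithm set_row mat_col 1.528 1.528 \<and>
        \<not> dynamic_product_algorithm set_col mat_row 1.528 1.528)"
proof -
  have "\<not> dynamic_product_algorithm set_row mat_col 1.528 1.528 \<and>
        \<not> dynamic_product_algorithm set_col mat_row 1.528 1.528"
    if \<tau>: "0.528 < \<tau>" "\<tau> < 1" "omega 1 1 \<tau> - \<tau> = 1 + \<tau>" for \<tau> :: real
  proof -
    \<comment> \<open>At the balance point both exponents are \<open>1 + \<tau>\<close> up to
      \<open>\<epsilon>\<close>; the choice \<open>\<epsilon> = \<tau> - 0.528\<close>, positive by
      assumption, lowers both to 1.528.\<close>
    have "omega 1 1 \<tau> - \<tau> - (\<tau> - 0.528) = 1.528" "1 + \<tau> - (\<tau> - 0.528) = 1.528"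
      using \<tau>(3) by simp_all
    then show ?thesis
      using no_dynamic_product[OF assms, of \<tau> "\<tau> - 0.528"] \<tau> by simp
  qed
  then show ?thesis using no_dynamic_product[OF assms] by blast
qed

end
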